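(* Consider the LMP game on the following network. There are two nodes, joined by one line of admittance $Y_{12}>0$ and capacity $C>0$. There are two generators, generator $1$ at node $1$ and generator $2$ at node $2$. The demands are $D_1=0$ and $D_2=D$ with $D>C$. The cost functions are $c_n(x_n)=a_nx_n$ for $n=1,2$, with $0\le a_1<a_2$. Then the LMP game has no (pure) Nash equilibrium. Moreover, this remains true under a bid cap: for every sufficiently large constant $a$, the LMP game in which bids are additionally required to satisfy $q_1,q_2\le a$ has no (pure) Nash equilibrium.
   Context: Network: a connected power network with nodes $i=1,\dots,I$; line $i$-$j$ has admittance $Y_{ij}=Y_{ji}>0$ ($Y_{ij}=0$ if there is no line) and capacity $C_{ij}=C_{ji}>0$. There are generators $n=1,\dots,N$; $\mathcal N_i$ is the set of generators at node $i$; generator $n$ has cost function $c_n:\mathbb R_+\to\mathbb R_+$ with $c_n(0)=0$, $c_n'\ge 0$, $c_n''\ge 0$. Node $i$ has inelastic demand $D_i\ge 0$. LMP game. Each generator $n$ submits a bid $(p_n,s_n,q_n)$ with $0\le p_n\le q_n$, $s_n\ge0$, identified with the function $b_n(x_n)=p_nx_n$ for $x_n\le s_n$ and $b_n(x_n)=q_nx_n+(p_n-q_n)s_n$ for $x_n>s_n$. Given the bid profile $b=(b_1,\dots,b_N)$, the dispatch $x=(x_1,\dots,x_N)$ is (the $x$-part of) an optimal solution $(x,\theta)$ of: minimize $\sum_n b_n(x_n)$ over $x_n,\theta_i\in\mathbb R$ subject to $\sum_{n\in\mathcal N_i}x_n-D_i=\sum_jY_{ij}(\theta_i-\theta_j)$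 for all $i$; $Y_{ij}(\theta_i-\theta_j)\le C_{ij}$ for all ordered pairs $(i,j)$ joined by a line; $x_n\ge0$ for all $n$. The locational marginal prices (LMPs) $\pi=(\pi_i)_i$ are the optimal Lagrange multipliers of the power balance equalities: there are $\mu_ij\ge0$, written $\mu_{ij}$, for the line constraints such that for $n\in\mathcal N_i$: $\pi_i$ lies between the left and right derivatives of $b_n$ at $x_n$ if $x_n>0$, and $\pi_i$ is at most the right derivative of $b_n$ at $0$ if $x_n=0$; $\sum_jY_{ij}(\pi_i-\pi_j+\mu_{ij}-\mu_{ji})=0$ for all $i$; and $\mu_{ij}[Y_{ij}(\theta_i-\theta_j)-C_{ij}]=0$ for all $(i,j)$. If the optimal $\pi$ is not unique, the lexicographically smallest one is used (first minimize $\pi_1$, then $\pi_2$, and so on). If the optimal $x$ is not unique, any optimal $x$ may be the dispatch associated with $b$. The pair $(x,\pi)$ is an outcome associated with $b$. The payoff of generator $n\in\mathcal N_i$ is $u_n=\pi_ix_n-c_n(x_n)$. A (pure) Nash equilibrium is a bid profile $b$ together with an associated outcome $(x,\pi)$ such that no generator can be strictly better off by a unilateral change of his bid (that is, for no generator $n$ and no alternative bid of $n$ does an outcome associated with the changed profile give $n$ a strictly larger payoff). *)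

theory Defs
  imports Complex_Main
begin

section \<open>Power networks\<close>

text \<open>Nodes are \<open>1, \<dots>, num_nodes\<close> and generators are \<open>1, \<dots>, num_gens\<close>; the values of
  the other fields outside these index ranges are never used. There is a line between
  \<open>i\<close> and \<open>j\<close> iff \<open>adm i j > 0\<close>.\<close>

record network =
  num_nodes :: nat
  num_gens :: nat
  adm :: "nat \<Rightarrow> nat \<Rightarrow> real"
  line_cap :: "nat \<Rightarrow> nat \<Rightarrow> real"
  gen_node :: "nat \<Rightarrow> nat"
  demand :: "nat \<Rightarrow> real"
  cost :: "nat \<Rightarrow> real \<Rightarrow> real"

definition nodes :: "network \<Rightarrow> nat set" where
  "nodes N = {1..num_nodes N}"

definition gens :: "network \<Rightarrow> nat set" where
  "gens N = {1..num_gens N}"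

definition gens_at :: "network \<Rightarrow> nat \<Rightarrow> nat set" where
  "gens_at N i = {n \<in> gens N. gen_node N n = i}"

definition lines :: "network \<Rightarrow> (nat \<times> nat) set" where
  "lines N = {(i, j). i \<in> nodes N \<and> j \<in> nodes N \<and> adm N i j > 0}"

definition admissible_cost :: "(real \<Rightarrow> real) \<Rightarrow> bool" where
  "admissible_cost c \<longleftrightarrow> c 0 = 0 \<and> (\<forall>x\<ge>0. c x \<ge> 0) \<and>
     (\<exists>c' c''. \<forall>x\<ge>0.
        (c has_real_derivative c' x) (at x within {0..}) \<and>
        (c' has_real_derivative c'' x) (at x within {0..}) \<and>
        c' x \<ge> 0 \<and> c'' x \<ge> 0)"

definition power_network :: "network \<Rightarrow> bool" where
  "power_network N \<longleftrightarrow>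
     (\<forall>i\<in>nodes N. \<forall>j\<in>nodes N. adm N i j \<ge> 0 \<and> adm N i j = adm N j i) \<and>
     (\<forall>(i, j)\<in>lines N. line_cap N i j > 0 \<and> line_cap N i j = line_cap N j i) \<and>
     (\<forall>i\<in>nodes N. \<forall>j\<in>nodes N. (i, j) \<in> (lines N)\<^sup>*) \<and>
     (\<forall>n\<in>gens N. gen_node N n \<in> nodes N \<and> admissible_cost (cost N n)) \<and>
     (\<forall>i\<in>nodes N. demand N i \<ge> 0)"


section \<open>Bids\<close>

datatype bid = Bid (bid_p: real) (bid_s: real) (bid_q: real)

definition bid_fun :: "bid \<Rightarrow> real \<Rightarrow> real" where
  "bid_fun b x = (if x \<le> bid_s b then bid_p b * x
                  else bid_q b * x + (bid_p b - bid_q b) * bid_s b)"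

definition valid_bids :: "bid set" where
  "valid_bids = {b. 0 \<le> bid_p b \<and> bid_p b \<le> bid_q b \<and> 0 \<le> bid_s b}"

definition capped_bids :: "real \<Rightarrow> bid set" where
  "capped_bids a = {b \<in> valid_bids. bid_q b \<le> a}"

text \<open>Bids are identified with their functions on the nonnegative outputs; different
  triples can describe the same bid.\<close>

definition same_bid :: "bid \<Rightarrow> bid \<Rightarrow> bool" where
  "same_bid b b' \<longleftrightarrow> (\<forall>x\<ge>0. bid_fun b x = bid_fun b' x)"


section \<open>Dispatch and locational marginal prices\<close>

definition feasible :: "network \<Rightarrow> (nat \<Rightarrow> real) \<Rightarrow> (nat \<Rightarrow> real) \<Rightarrow> bool" where
  "feasible N x \<theta> \<longleftrightarrow>
     (\<forall>i\<in>nodes N. (\<Sum>n\<in>gens_at N i. x n) - demand N i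
                    = (\<Sum>j\<in>nodes N. adm N i j * (\<theta> i - \<theta> j))) \<and>
     (\<forall>(i, j)\<in>lines N. adm N i j * (\<theta> i - \<theta> j) \<le> line_cap N i j) \<and>
     (\<forall>n\<in>gens N. x n \<ge> 0)"

definition bid_total :: "network \<Rightarrow> (nat \<Rightarrow> bid) \<Rightarrow> (nat \<Rightarrow> real) \<Rightarrow> real" where
  "bid_total N b x = (\<Sum>n\<in>gens N. bid_fun (b n) (x n))"

definition optimal_solution ::
  "network \<Rightarrow> (nat \<Rightarrow> bid) \<Rightarrow> (nat \<Rightarrow> real) \<Rightarrow> (nat \<Rightarrow> real) \<Rightarrow> bool" where
  "optimal_solution N b x \<theta> \<longleftrightarrow> feasible N x \<theta> \<and>
     (\<forall>x' \<theta>'. feasible N x' \<theta>' \<longrightarrow> bid_total N b x \<le> bid_total N b x')"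

definition price_supported :: "bid \<Rightarrow> real \<Rightarrow> real \<Rightarrow> bool" where
  "price_supported b y p \<longleftrightarrow>
     (y > 0 \<longrightarrow> (\<exists>l r. (bid_fun b has_real_derivative l) (at_left y) \<and>
                        (bid_fun b has_real_derivative r) (at_right y) \<and> l \<le> p \<and> p \<le> r)) \<and>
     (y = 0 \<longrightarrow> (\<exists>r. (bid_fun b has_real_derivative r) (at_right 0) \<and> p \<le> r))"

definition optimal_multipliers ::
  "network \<Rightarrow> (nat \<Rightarrow> bid) \<Rightarrow> (nat \<Rightarrow> real) \<Rightarrow> (nat \<Rightarrow> real) \<Rightarrow> (nat \<Rightarrow> real) \<Rightarrow> bool" where
  "optimal_multipliers N b x \<theta> \<pi> \<longleftrightarrow>
     (\<exists>\<mu> :: nat \<Rightarrow> nat \<Rightarrow> real.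
        (\<forall>(i, j)\<in>lines N. \<mu> i j \<ge> 0) \<and>
        (\<forall>i\<in>nodes N. \<forall>n\<in>gens_at N i. price_supported (b n) (x n) (\<pi> i)) \<and>
        (\<forall>i\<in>nodes N. (\<Sum>j\<in>nodes N. adm N i j * (\<pi> i - \<pi> j + \<mu> i j - \<mu> j i)) = 0) \<and>
        (\<forall>(i, j)\<in>lines N. \<mu> i j * (adm N i j * (\<theta> i - \<theta> j) - line_cap N i j) = 0))"

definition lex_less :: "network \<Rightarrow> (nat \<Rightarrow> real) \<Rightarrow> (nat \<Rightarrow> real) \<Rightarrow> bool" where
  "lex_less N \<pi>' \<pi> \<longleftrightarrow> (\<exists>i\<in>nodes N. \<pi>' i < \<pi> i \<and> (\<forall>j\<in>nodes N. j < i \<longrightarrow> \<pi>' j = \<pi> j))"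

definition is_LMP ::
  "network \<Rightarrow> (nat \<Rightarrow> bid) \<Rightarrow> (nat \<Rightarrow> real) \<Rightarrow> (nat \<Rightarrow> real) \<Rightarrow> (nat \<Rightarrow> real) \<Rightarrow> bool" where
  "is_LMP N b x \<theta> \<pi> \<longleftrightarrow> optimal_multipliers N b x \<theta> \<pi> \<and>
     \<not> (\<exists>\<pi>'. optimal_multipliers N b x \<theta> \<pi>' \<and> lex_less N \<pi>' \<pi>)"

definition outcome ::
  "network \<Rightarrow> (nat \<Rightarrow> bid) \<Rightarrow> (nat \<Rightarrow> real) \<Rightarrow> (nat \<Rightarrow> real) \<Rightarrow> bool" where
  "outcome N b x \<pi> \<longleftrightarrow> (\<exists>\<theta>. optimal_solution N b x \<theta> \<and> is_LMP N b x \<theta> \<pi>)"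


section \<open>The LMP game\<close>

definition payoff :: "network \<Rightarrow> (nat \<Rightarrow> real) \<Rightarrow> (nat \<Rightarrow> real) \<Rightarrow> nat \<Rightarrow> real" where
  "payoff N x \<pi> n = \<pi> (gen_node N n) * x n - cost N n (x n)"

text \<open>\<open>B\<close> is the set of bids the generators may submit. Only genuine changes of a bid count as
  deviations: resubmitting the same bid cannot be used to switch to another outcome of the same
  profile.\<close>

definition nash_equilibrium ::
  "network \<Rightarrow> bid set \<Rightarrow> (nat \<Rightarrow> bid) \<Rightarrow> (nat \<Rightarrow> real) \<Rightarrow> (nat \<Rightarrow> real) \<Rightarrow> bool" where
  "nash_equilibrium N B b x \<pi> \<longleftrightarrow>
     (\<forall>n\<in>gens N. b n \<in> B) \<and> outcome N b x \<pi> \<and>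
     \<not> (\<exists>n\<in>gens N. \<exists>b'\<in>B. \<not> same_bid b' (b n) \<and>
          (\<exists>x' \<pi>'. outcome N (b(n := b')) x' \<pi>' \<and> payoff N x' \<pi>' n > payoff N x \<pi> n))"


section \<open>The two-node network\<close>

definition two_node_network :: "real \<Rightarrow> real \<Rightarrow> real \<Rightarrow> real \<Rightarrow> real \<Rightarrow> network" where
  "two_node_network Y C D a1 a2 =
     \<lparr> num_nodes = 2, num_gens = 2,
       adm = (\<lambda>i j. if i = j then 0 else Y),
       line_cap = (\<lambda>i j. C),
       gen_node = (\<lambda>n. n),
       demand = (\<lambda>i. if i = 2 then D else 0),
       cost = (\<lambda>n x. (if n = 1 then a1 else a2) * x) \<rparr>"

lemma power_network_two_node:
  assumes "Y > 0" "C > 0" "D > C" "0 \<le> a1" "a1 < a2"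
  shows "power_network (two_node_network Y C D a1 a2)"
proof -
  let ?N = "two_node_network Y C D a1 a2"
  have n: "nodes ?N = {1, 2}" "gens ?N = {1, 2}"
    by (auto simp: nodes_def gens_def two_node_network_def)
  have l: "lines ?N = {(1, 2), (2, 1)}"
    using assms unfolding lines_def n by (auto simp: two_node_network_def split: if_splits)
  have c: "admissible_cost (\<lambda>x. a * x)" if "a \<ge> 0" for a
  proof -
    have "((\<lambda>x. a * x) has_real_derivative a) (at x within {0..}) \<and>
          ((\<lambda>x. a) has_real_derivative 0) (at x within {0..})" for x
      by (auto intro!: derivative_eq_intros)
    with that show ?thesis
      unfolding admissible_cost_def
      by (intro conjI exI[of _ "\<lambda>_. a"] exI[of _ "\<lambda>_. 0"]) auto
  qed
  show ?thesis
    unfolding power_network_def n l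
    using assms c[of a1] c[of a2] by (auto simp: two_node_network_def)
qed

end

theory Submission
  imports Defs
begin

text \<open>Generator 2 can always sell at least \<open>D - C > 0\<close>, at any price it likes if there is no cap:
  its payoff is then unbounded, so there is no equilibrium. Under a cap \<open>a > a2\<close>, bidding the flat
  price \<open>a\<close> guarantees it \<open>(a - a2) * (D - C) > 0\<close>, so in equilibrium \<open>\<pi> 2 > a2 > a1\<close>. If generator 1's
  left slope sets \<open>\<pi> 2\<close>, generator 2 gains volume by bidding a flat price just below \<open>\<pi> 2\<close>. Otherwise
  generator 2's left slope sets \<open>\<pi> 2\<close>; if the line is not congested, generator 1 gains volume by
  undercutting in the same way, and if it is congested, the guarantee forces \<open>\<pi> 2 = a\<close> and
  generator 1 gains by raising its price towards \<open>\<pi> 2\<close>.\<close>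

section \<open>One-sided slopes and convexity of bid functions\<close>

definition left_slope :: "bid \<Rightarrow> real \<Rightarrow> real" where
  "left_slope b y = (if y \<le> bid_s b then bid_p b else bid_q b)"

text \<open>Differs from \<open>left_slope\<close> only at the kink
  \<open>y = bid_s b\<close>.\<close>

definition right_slope :: "bid \<Rightarrow> real \<Rightarrow> real" where
  "right_slope b y = (if y < bid_s b then bid_p b else bid_q b)"

lemma left_slope_le_right_slope: "b \<in> valid_bids \<Longrightarrow> left_slope b y \<le> right_slope b y"
  by (auto simp: left_slope_def right_slope_def valid_bids_def)

lemma left_slope_bounds: "b \<in> valid_bids \<Longrightarrow> 0 \<le> left_slope b y \<and> left_slope b y \<le> bid_q b"
  by (auto simp: left_slope_def valid_bids_def)

lemma slope_linear_bid:
  "0 < y \<Longrightarrow> left_slope (Bid P 0 P) y = P" "right_slope (Bid P 0 P) y = P"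
  by (auto simp: left_slope_def right_slope_def)

lemma has_derivative_left_slope:
  "(bid_fun b has_real_derivative left_slope b y) (at_left y)"
proof (cases "y \<le> bid_s b")
  case True
  have "((\<lambda>x. bid_p b * x) has_real_derivative bid_p b) (at_left y)"
    by (auto intro!: derivative_eq_intros)
  moreover have "eventually (\<lambda>x. bid_p b * x = bid_fun b x) (at_left y)"
    using True by (auto simp: eventually_at_filter bid_fun_def)
  ultimately show ?thesis
    using True by (subst (asm) has_field_derivative_cong_eventually)
      (auto simp: left_slope_def bid_fun_def)
next
  case False
  have "((\<lambda>x. bid_q b * x + (bid_p b - bid_q b) * bid_s b) has_real_derivative bid_q b) (at_left y)"
    by (auto intro!: derivative_eq_intros)
  moreover have "eventually (\<lambda>x. x > bid_s b) (at_left y)"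
    using False by (intro eventually_at_left_real[THEN eventually_mono]) auto
  then have "eventually (\<lambda>x. bid_q b * x + (bid_p b - bid_q b) * bid_s b = bid_fun b x) (at_left y)"
    by eventually_elim (auto simp: bid_fun_def)
  ultimately show ?thesis
    using False by (subst (asm) has_field_derivative_cong_eventually)
      (auto simp: left_slope_def bid_fun_def)
qed

lemma has_derivative_right_slope:
  "(bid_fun b has_real_derivative right_slope b y) (at_right y)"
proof (cases "y < bid_s b")
  case False
  have "((\<lambda>x. bid_q b * x + (bid_p b - bid_q b) * bid_s b) has_real_derivative bid_q b) (at_right y)"
    by (auto intro!: derivative_eq_intros)
  moreover have "eventually (\<lambda>x. bid_q b * x + (bid_p b - bid_q b) * bid_s b = bid_fun b x) (at_right y)"
    using False by (auto simp: eventually_at_filter bid_fun_def)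
  ultimately show ?thesis
    using False by (subst (asm) has_field_derivative_cong_eventually)
      (auto simp: right_slope_def bid_fun_def algebra_simps)
next
  case True
  have "((\<lambda>x. bid_p b * x) has_real_derivative bid_p b) (at_right y)"
    by (auto intro!: derivative_eq_intros)
  moreover have "eventually (\<lambda>x. x < bid_s b) (at_right y)"
    using True by (intro eventually_at_right_real[THEN eventually_mono]) auto
  then have "eventually (\<lambda>x. bid_p b * x = bid_fun b x) (at_right y)"
    by eventually_elim (auto simp: bid_fun_def)
  ultimately show ?thesis
    using True by (subst (asm) has_field_derivative_cong_eventually)
      (auto simp: right_slope_def bid_fun_def)
qed

lemma has_real_derivative_within_unique:
  fixes f :: "real \<Rightarrow> real"
  assumes "(f has_real_derivative D) (at x within S)" "(f has_real_derivative E) (at x within S)"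
    and "at x within S \<noteq> bot"
  shows "D = E"
  using assms by (auto simp: has_field_derivative_iff intro: tendsto_unique)

text \<open>One-sided derivatives are unique, so the existentials collapse to inequalities. At
  output 0 only the upper bound remains.\<close>

lemma price_supported_iff:
  assumes "0 \<le> y"
  shows "price_supported b y t \<longleftrightarrow> (0 < y \<longrightarrow> left_slope b y \<le> t) \<and> t \<le> right_slope b y"
proof -
  have l: "(bid_fun b has_real_derivative l) (at_left y) \<longleftrightarrow> l = left_slope b y" for l
    using has_derivative_left_slope has_real_derivative_within_unique trivial_limit_at_left_real
    by blast
  have r: "(bid_fun b has_real_derivative r) (at_right z) \<longleftrightarrow> r = right_slope b z" for r z
    using has_derivative_right_slope has_real_derivative_within_unique trivial_limit_at_right_real
    by blast
  show ?thesis
    unfolding price_supported_def l r using assms by auto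
qed

text \<open>Since \<open>p \<le> q\<close>, a bid function is convex, so a supporting price is a
  subgradient. This lets prices certify optimal dispatch.\<close>

lemma bid_fun_subgradient:
  assumes "b \<in> valid_bids" "price_supported b y t" "0 \<le> y" "0 \<le> z"
  shows "bid_fun b y + t * (z - y) \<le> bid_fun b z"
proof -
  obtain p s q where b: "b = Bid p s q" by (cases b)
  have v: "0 \<le> p" "p \<le> q" "0 \<le> s"
    using assms(1) by (auto simp: valid_bids_def b)
  have right: "right_slope b y * (z - y) \<le> bid_fun b z - bid_fun b y" if "y \<le> z"
  proof (cases "y < s \<and> s < z")
    case True
    \<comment> \<open>With the kink strictly between \<open>y\<close> and \<open>z\<close>, this
      product is exactly the slack in the inequality.\<close>
    have "0 \<le> (q - p) * (z - s)" using True v by simp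
    then show ?thesis using True by (simp add: b right_slope_def bid_fun_def algebra_simps)
  next
    case False
    then show ?thesis using that v
      by (cases "z = s"; cases "y = s") (auto simp: b right_slope_def bid_fun_def algebra_simps)
  qed
  have left: "left_slope b y * (z - y) \<le> bid_fun b z - bid_fun b y" if "z \<le> y"
  proof (cases "z < s \<and> s < y")
    case True
    have "0 \<le> (q - p) * (s - z)" using True v by simp
    then show ?thesis using True by (simp add: b left_slope_def bid_fun_def algebra_simps)
  next
    case False
    then show ?thesis using that v
      by (cases "z = s"; cases "y = s") (auto simp: b left_slope_def bid_fun_def algebra_simps)
  qed
  consider "y \<le> z" | "z < y" by linarith
  then show ?thesis
  proof cases
    case 1
    have "t * (z - y) \<le> right_slope b y * (z - y)"
      using assms(2,3) 1 by (intro mult_right_mono) (auto simp: price_supported_iff)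
    with right[OF 1] show ?thesis by linarith
  next
    case 2
    have "left_slope b y \<le> t"
      using assms(2-4) 2 by (auto simp: price_supported_iff)
    then have "t * (z - y) \<le> left_slope b y * (z - y)"
      using 2 by (intro mult_right_mono_neg) auto
    with left 2 show ?thesis by linarith
  qed
qed

text \<open>Used contrapositively: only genuine changes of bid count as deviations, and one positive
  output where the current left slope is not \<open>P\<close> certifies that the flat bid is
  one.\<close>

lemma same_bid_linear:
  assumes "same_bid (Bid P 0 P) b" "b \<in> valid_bids" "0 < y"
  shows "left_slope b y = P"
proof -
  obtain p s q where b: "b = Bid p s q" by (cases b)
  have v: "0 \<le> s"
    using assms(2) by (auto simp: valid_bids_def b)
  have eq: "P * x = bid_fun b x" if "0 \<le> x" for x
  proof -
    have "bid_fun (Bid P 0 P) x = bid_fun b x" using assms(1) that by (simp add: same_bid_def)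
    then show ?thesis using that by (cases "x = 0") (auto simp: bid_fun_def[of "Bid P 0 P"])
  qed
  show ?thesis
  proof (cases "y \<le> s")
    case True
    then show ?thesis using eq[of y] assms(3) by (simp add: b bid_fun_def left_slope_def)
  next
    case False
    \<comment> \<open>Subtracting the identity at the kink \<open>s\<close> from the one at
      \<open>y\<close> isolates the upper slope \<open>q\<close>.\<close>
    have "P * y = q * y + (p - q) * s"
      using eq[of y] False v by (simp add: b bid_fun_def)
    moreover have "P * s = p * s"
      using eq[of s] v by (simp add: b bid_fun_def)
    ultimately have "P * (y - s) = q * (y - s)"
      unfolding right_diff_distrib left_diff_distrib by linarith
    then show ?thesis using False by (simp add: b left_slope_def)
  qed
qed


section \<open>Outcomes on the two-node network\<close>

locale two_nodes =
  fixes Y C D a1 a2 :: real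
  assumes Y: "Y > 0" and C: "C > 0" and D: "D > C" and a1: "0 \<le> a1" and a12: "a1 < a2"
begin

abbreviation "N \<equiv> two_node_network Y C D a1 a2"

lemma nodes_N: "nodes N = {1, 2}" and gens_N: "gens N = {1, 2}"
  by (auto simp: nodes_def gens_def two_node_network_def)

lemma lines_N: "lines N = {(1, 2), (2, 1)}"
  using Y unfolding lines_def nodes_N by (auto simp: two_node_network_def split: if_splits)

lemma gens_at_N: "i \<in> {1, 2} \<Longrightarrow> gens_at N i = {i}"
  unfolding gens_at_def gens_N by (auto simp: two_node_network_def)

lemma adm_N: "adm N i j = (if i = j then 0 else Y)" "line_cap N i j = C"
  by (auto simp: two_node_network_def)

lemma payoff_N:
  "payoff N x \<pi> 1 = (\<pi> 1 - a1) * x 1" "payoff N x \<pi> 2 = (\<pi> 2 - a2) * x 2"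
  by (auto simp: payoff_def two_node_network_def algebra_simps)

text \<open>Node 1 has no demand, so \<open>x 1\<close> is the flow on the line and the only free
  quantity; \<open>D > C\<close> keeps \<open>x 2\<close> positive.\<close>

lemma feasible_N:
  "feasible N x \<theta> \<longleftrightarrow>
     x 2 = D - x 1 \<and> x 1 = Y * (\<theta> 1 - \<theta> 2) \<and> 0 \<le> x 1 \<and> x 1 \<le> C"
  unfolding feasible_def nodes_N lines_N gens_N using C D
  by (simp add: gens_at_N) (auto simp: two_node_network_def algebra_simps)

text \<open>The optimality conditions after eliminating angles and line multipliers:
  \<open>y\<close> is generator 1's output and also the flow, and the prices may differ only on a
  full line.\<close>

definition clears :: "(nat \<Rightarrow> bid) \<Rightarrow> real \<Rightarrow> real \<Rightarrow> real \<Rightarrow> bool" where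
  "clears b y t1 t2 \<longleftrightarrow> price_supported (b 1) y t1 \<and> price_supported (b 2) (D - y) t2 \<and>
     t1 \<le> t2 \<and> (y < C \<longrightarrow> t1 = t2)"

text \<open>Since \<open>x 1 \<ge> 0\<close>, the line from node 2 to node 1 is never congested, so only
  \<open>\<mu> 1 2 = \<pi> 2 - \<pi> 1\<close> survives.\<close>

lemma optimal_multipliers_N:
  assumes "feasible N x \<theta>"
  shows "optimal_multipliers N b x \<theta> \<pi> \<longleftrightarrow> clears b (x 1) (\<pi> 1) (\<pi> 2)"
proof -
  have f: "x 2 = D - x 1" "x 1 = Y * (\<theta> 1 - \<theta> 2)" "0 \<le> x 1" "x 1 \<le> C"
    using assms by (auto simp: feasible_N)
  have f': "Y * (\<theta> 2 - \<theta> 1) = - x 1" using f(2) by (simp add: algebra_simps)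
  have "optimal_multipliers N b x \<theta> \<pi> \<longleftrightarrow>
     price_supported (b 1) (x 1) (\<pi> 1) \<and> price_supported (b 2) (D - x 1) (\<pi> 2) \<and>
     (\<exists>\<mu> :: nat \<Rightarrow> nat \<Rightarrow> real. \<mu> 1 2 \<ge> 0 \<and> \<mu> 2 1 \<ge> 0 \<and> Y * (\<pi> 1 - \<pi> 2 + \<mu> 1 2 - \<mu> 2 1) = 0 \<and>
        Y * (\<pi> 2 - \<pi> 1 + \<mu> 2 1 - \<mu> 1 2) = 0 \<and>
        \<mu> 1 2 * (x 1 - C) = 0 \<and> \<mu> 2 1 * (- x 1 - C) = 0)"
    unfolding optimal_multipliers_def nodes_N lines_N
    by (simp add: gens_at_N adm_N f(1) f(2)[symmetric] f' del: One_nat_def mult_eq_0_iff) blast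
  also have "\<dots> \<longleftrightarrow> clears b (x 1) (\<pi> 1) (\<pi> 2)" (is "_ \<and> _ \<and> ?M \<longleftrightarrow> _")
  proof -
    have "?M \<longleftrightarrow> \<pi> 1 \<le> \<pi> 2 \<and> (x 1 < C \<longrightarrow> \<pi> 1 = \<pi> 2)"
    proof
      assume ?M
      then show "\<pi> 1 \<le> \<pi> 2 \<and> (x 1 < C \<longrightarrow> \<pi> 1 = \<pi> 2)" using Y C f(3) by auto
    next
      assume "\<pi> 1 \<le> \<pi> 2 \<and> (x 1 < C \<longrightarrow> \<pi> 1 = \<pi> 2)"
      then show ?M using f(4)
        by (intro exI[of _ "\<lambda>i j. if i = 1 then \<pi> 2 - \<pi> 1 else 0"]) auto
    qed
    then show ?thesis by (auto simp: clears_def)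
  qed
  finally show ?thesis .
qed

text \<open>Adding the two subgradient inequalities leaves \<open>(t1 - t2) * (x' 1 - x 1)\<close>.
  It is nonnegative: below capacity the prices agree, and at capacity both factors are
  nonpositive.\<close>

lemma clears_imp_optimal:
  assumes "feasible N x \<theta>" "clears b (x 1) t1 t2" "b 1 \<in> valid_bids" "b 2 \<in> valid_bids"
  shows "optimal_solution N b x \<theta>"
  unfolding optimal_solution_def
proof (intro conjI allI impI)
  fix x' \<theta>' assume "feasible N x' \<theta>'"
  then have x': "x' 2 = D - x' 1" "0 \<le> x' 1" "x' 1 \<le> C" by (auto simp: feasible_N)
  have x: "x 2 = D - x 1" "0 \<le> x 1" "x 1 \<le> C" using assms(1) by (auto simp: feasible_N)
  have c: "price_supported (b 1) (x 1) t1" "price_supported (b 2) (x 2) t2"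
      "t1 \<le> t2" "x 1 < C \<longrightarrow> t1 = t2"
    using assms(2) x by (auto simp: clears_def)
  have "bid_fun (b 1) (x 1) + t1 * (x' 1 - x 1) \<le> bid_fun (b 1) (x' 1)"
    using bid_fun_subgradient assms(3) c(1) x x' by blast
  moreover have "bid_fun (b 2) (x 2) + t2 * (x' 2 - x 2) \<le> bid_fun (b 2) (x' 2)"
    using bid_fun_subgradient[OF assms(4) c(2), of "x' 2"] x x' D by simp
  moreover have "t2 * (x' 2 - x 2) = - t2 * (x' 1 - x 1)"
    unfolding x(1) x'(1) by (simp add: algebra_simps)
  moreover have "0 \<le> (t1 - t2) * (x' 1 - x 1)"
    using c(3,4) x(3) x'(3) by (cases "x 1 < C") (auto intro: mult_nonpos_nonpos)
  ultimately show "bid_total N b x \<le> bid_total N b x'"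
    unfolding bid_total_def gens_N by (simp add: algebra_simps)
qed (fact assms(1))

text \<open>Closed form of the smallest price at node 2. An idle generator 1 imposes no lower bound
  on it, hence the case \<open>y = 0\<close>.\<close>

definition lmp2 :: "(nat \<Rightarrow> bid) \<Rightarrow> real \<Rightarrow> real" where
  "lmp2 b y = (if y = 0 then left_slope (b 2) D
     else max (left_slope (b 1) y) (left_slope (b 2) (D - y)))"

text \<open>On a full line the price at node 1 can fall separately, down to generator 1's own left
  slope.\<close>

definition lmp1 :: "(nat \<Rightarrow> bid) \<Rightarrow> real \<Rightarrow> real" where
  "lmp1 b y = (if y = C then left_slope (b 1) C else lmp2 b y)"

text \<open>For fixed output the clearing prices are cut out by interval bounds: the two slope
  inequalities say when such prices exist, and \<open>lmp1\<close>, \<open>lmp2\<close> are the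
  least ones.\<close>

lemma outcome_N:
  assumes "b 1 \<in> valid_bids" "b 2 \<in> valid_bids"
  shows "outcome N b x \<pi> \<longleftrightarrow>
    0 \<le> x 1 \<and> x 1 \<le> C \<and> x 2 = D - x 1 \<and>
    (0 < x 1 \<longrightarrow> left_slope (b 1) (x 1) \<le> right_slope (b 2) (x 2)) \<and>
    (x 1 < C \<longrightarrow> left_slope (b 2) (x 2) \<le> right_slope (b 1) (x 1)) \<and>
    \<pi> 1 = lmp1 b (x 1) \<and> \<pi> 2 = lmp2 b (x 1)"
    (is "_ \<longleftrightarrow> ?R")
proof -
  have lr: "left_slope (b 1) y \<le> right_slope (b 1) y" "left_slope (b 2) y \<le> right_slope (b 2) y" for y
    using assms left_slope_le_right_slope by auto
  have lex: "lex_less N \<pi>' \<pi> \<longleftrightarrow> \<pi>' 1 < \<pi> 1 \<or> \<pi>' 1 = \<pi> 1 \<and> \<pi>' 2 < \<pi> 2" for \<pi>'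
    unfolding lex_less_def nodes_N by auto
  define least where "least y t1 t2 \<longleftrightarrow> clears b y t1 t2 \<and>
    (\<forall>u1 u2. clears b y u1 u2 \<longrightarrow> \<not> (u1 < t1 \<or> u1 = t1 \<and> u2 < t2))" for y t1 t2
  have cl: "clears b y t1 t2 \<longleftrightarrow>
      (0 < y \<longrightarrow> left_slope (b 1) y \<le> t1) \<and> t1 \<le> right_slope (b 1) y \<and>
      left_slope (b 2) (D - y) \<le> t2 \<and> t2 \<le> right_slope (b 2) (D - y) \<and>
      t1 \<le> t2 \<and> (y < C \<longrightarrow> t1 = t2)" if "0 \<le> y" "y \<le> C" for y t1 t2
    using that D by (auto simp: clears_def price_supported_iff)
  have "outcome N b x \<pi> \<longleftrightarrow> 0 \<le> x 1 \<and> x 1 \<le> C \<and> x 2 = D - x 1 \<and> least (x 1) (\<pi> 1) (\<pi> 2)"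
    (is "_ \<longleftrightarrow> ?S")
  proof
    assume "outcome N b x \<pi>"
    then obtain \<theta> where o: "feasible N x \<theta>" "is_LMP N b x \<theta> \<pi>"
      by (auto simp: outcome_def optimal_solution_def)
    have "\<not> (u1 < \<pi> 1 \<or> u1 = \<pi> 1 \<and> u2 < \<pi> 2)" if "clears b (x 1) u1 u2" for u1 u2
    proof -
      have "optimal_multipliers N b x \<theta> (\<lambda>n. if n = 1 then u1 else u2)"
        using that by (simp add: optimal_multipliers_N[OF o(1)])
      then have "\<not> lex_less N (\<lambda>n. if n = 1 then u1 else u2) \<pi>"
        using o(2) by (auto simp: is_LMP_def)
      then show ?thesis by (auto simp: lex)
    qed
    then show ?S
      using o by (auto simp: is_LMP_def optimal_multipliers_N feasible_N least_def)
  next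
    assume S: ?S
    \<comment> \<open>Node 2 is the reference angle; angle 1 then reproduces the flow
      \<open>x 1\<close>.\<close>
    define \<theta> where "\<theta> = (\<lambda>n::nat. if n = 1 then x 1 / Y else 0)"
    have f: "feasible N x \<theta>" using S Y by (auto simp: feasible_N \<theta>_def)
    have "is_LMP N b x \<theta> \<pi>"
      using S by (auto simp: is_LMP_def optimal_multipliers_N[OF f] least_def lex)
    moreover have "optimal_solution N b x \<theta>"
      using S clears_imp_optimal[OF f _ assms] by (auto simp: least_def)
    ultimately show "outcome N b x \<pi>" by (auto simp: outcome_def)
  qed
  also have "\<dots> \<longleftrightarrow> ?R"
  proof -
    have "least y t1 t2 \<longleftrightarrow>
      (0 < y \<longrightarrow> left_slope (b 1) y \<le> right_slope (b 2) (D - y)) \<and>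
      (y < C \<longrightarrow> left_slope (b 2) (D - y) \<le> right_slope (b 1) y) \<and>
      t1 = lmp1 b y \<and> t2 = lmp2 b y" (is "_ \<longleftrightarrow> ?E \<and> ?F \<and> _ \<and> _")
      if y: "0 \<le> y" "y \<le> C" for y t1 t2
    proof -
      have ex: "?E \<and> ?F" if "clears b y u1 u2" for u1 u2
        using that by (auto simp: cl[OF y])
      have m: "clears b y (lmp1 b y) (lmp2 b y)" if "?E" "?F"
        using that lr[of y] lr[of "D - y"] y C by (auto simp: cl[OF y] lmp1_def lmp2_def)
      \<comment> \<open>Minimality holds in each coordinate separately, which is stronger than
        lexicographic minimality.\<close>
      have ge: "lmp1 b y \<le> u1 \<and> lmp2 b y \<le> u2" if "clears b y u1 u2" for u1 u2
        using that y C by (auto simp: cl[OF y] lmp1_def lmp2_def)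
      show ?thesis
      proof
        assume l: "least y t1 t2"
        then have t: "clears b y t1 t2" by (simp add: least_def)
        have "\<not> (lmp1 b y < t1 \<or> lmp1 b y = t1 \<and> lmp2 b y < t2)"
          using l m ex[OF t] by (auto simp: least_def)
        with ge[OF t] ex[OF t] show "?E \<and> ?F \<and> t1 = lmp1 b y \<and> t2 = lmp2 b y"
          by auto
      next
        assume "?E \<and> ?F \<and> t1 = lmp1 b y \<and> t2 = lmp2 b y"
        with m ge show "least y t1 t2" unfolding least_def by force
      qed
    qed
    then show ?thesis by auto
  qed
  finally show ?thesis .
qed

end


section \<open>Deviations to linear bids\<close>

text \<open>The bid set \<open>B\<close> stays abstract so that the deviation bounds serve both the
  uncapped and the capped game.\<close>

locale equilibrium = two_nodes +
  fixes B b x \<pi>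
  assumes B: "B \<subseteq> valid_bids"
    and nash: "nash_equilibrium (two_node_network Y C D a1 a2) B b x \<pi>"
begin

lemma valid: "b 1 \<in> valid_bids" "b 2 \<in> valid_bids"
  using nash B unfolding nash_equilibrium_def gens_N by auto

lemma outcome:
  "0 \<le> x 1" "x 1 \<le> C" "x 2 = D - x 1" "\<pi> 1 = lmp1 b (x 1)" "\<pi> 2 = lmp2 b (x 1)"
  using nash valid by (auto simp: nash_equilibrium_def outcome_N)

lemma no_profitable_deviation:
  assumes "n \<in> {1, 2}" "b' \<in> B" "\<not> same_bid b' (b n)" "outcome N (b(n := b')) x' \<pi>'"
  shows "payoff N x' \<pi>' n \<le> payoff N x \<pi> n"
  using nash assms unfolding nash_equilibrium_def gens_N by (meson not_le)

text \<open>Under the slope conditions the flat bid \<open>P\<close> can be dispatched at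
  \<open>y\<close> and is paid exactly \<open>P\<close>. Any associated outcome may be used against
  an equilibrium, so ties are resolved in the deviator's favor. The witness \<open>z\<close> shows
  that the bid really changes.\<close>

lemma linear_deviation1:
  assumes P: "Bid P 0 P \<in> B" and y: "0 < y" "y \<le> C"
    and "P \<le> right_slope (b 2) (D - y)" "y < C \<Longrightarrow> left_slope (b 2) (D - y) \<le> P"
    and z: "0 < z" "left_slope (b 1) z \<noteq> P"
  shows "(P - a1) * y \<le> (\<pi> 1 - a1) * x 1"
proof -
  let ?b = "b(1 := Bid P 0 P)"
  let ?x = "\<lambda>n::nat. if n = 1 then y else D - y"
  let ?\<pi> = "\<lambda>n::nat. if n = 1 then lmp1 ?b y else lmp2 ?b y"
  have v: "?b 1 \<in> valid_bids" "?b 2 \<in> valid_bids" using P B valid by auto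
  have o: "outcome N ?b ?x ?\<pi>"
    unfolding outcome_N[of ?b, OF v] using assms by (simp add: slope_linear_bid)
  have "\<not> same_bid (Bid P 0 P) (b 1)"
    using same_bid_linear z valid by blast
  from no_profitable_deviation[OF _ P this o] have "(lmp1 ?b y - a1) * y \<le> (\<pi> 1 - a1) * x 1"
    by (simp add: payoff_N del: One_nat_def)
  moreover have "lmp1 ?b y = P"
    using assms C by (auto simp: lmp1_def lmp2_def slope_linear_bid)
  ultimately show ?thesis by simp
qed

lemma linear_deviation2:
  assumes P: "Bid P 0 P \<in> B" and y: "0 \<le> y" "y \<le> C"
    and "0 < y \<Longrightarrow> left_slope (b 1) y \<le> P" "y < C \<Longrightarrow> P \<le> right_slope (b 1) y"
    and z: "0 < z" "left_slope (b 2) z \<noteq> P"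
  shows "(P - a2) * (D - y) \<le> (\<pi> 2 - a2) * x 2"
proof -
  let ?b = "b(2 := Bid P 0 P)"
  let ?x = "\<lambda>n::nat. if n = 1 then y else D - y"
  let ?\<pi> = "\<lambda>n::nat. if n = 1 then lmp1 ?b y else lmp2 ?b y"
  have v: "?b 1 \<in> valid_bids" "?b 2 \<in> valid_bids" using P B valid by auto
  have o: "outcome N ?b ?x ?\<pi>"
    unfolding outcome_N[of ?b, OF v] using assms D by (simp add: slope_linear_bid)
  have "\<not> same_bid (Bid P 0 P) (b 2)"
    using same_bid_linear z valid by blast
  from no_profitable_deviation[OF _ P this o] have "(lmp2 ?b y - a2) * (D - y) \<le> (\<pi> 2 - a2) * x 2"
    by (simp add: payoff_N del: One_nat_def)
  moreover have "lmp2 ?b y = P"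
    using assms C D by (auto simp: lmp2_def slope_linear_bid)
  ultimately show ?thesis by simp
qed

end

text \<open>A strict gain at price \<open>p\<close> survives a small enough price cut. The excluded
  value \<open>e\<close> will be a slope of the current bid, to make the deviation genuine.\<close>

lemma slightly_lower_price:
  fixes K p \<alpha> u y e :: real
  assumes "K < p" "u < (p - \<alpha>) * y" "0 < y"
  obtains P where "K < P" "P < p" "u < (P - \<alpha>) * y" "P \<noteq> e"
proof -
  \<comment> \<open>\<open>\<alpha> + u / y\<close> is the price at which volume \<open>y\<close>
    earns exactly \<open>u\<close>; \<open>e\<close> enters the maximum only when it lies below
    \<open>p\<close>.\<close>
  define M where "M = max (max K (\<alpha> + u / y)) (if e < p then e else K)"
  have "\<alpha> + u / y < p" using assms by (simp add: field_simps)
  then have "M < p" using assms by (auto simp: M_def)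
  then obtain P where P: "M < P" "P < p" using dense by blast
  have "\<alpha> + u / y < P" using P by (auto simp: M_def)
  then have "u < (P - \<alpha>) * y" using assms by (simp add: field_simps)
  then show thesis using that[of P] P by (auto simp: M_def split: if_splits)
qed

section \<open>Nonexistence of equilibria without and with a bid cap\<close>

context two_nodes
begin

lemma no_equilibrium_uncapped: "\<not> nash_equilibrium N valid_bids b x \<pi>"
proof
  assume "nash_equilibrium N valid_bids b x \<pi>"
  then interpret equilibrium Y C D a1 a2 valid_bids b x \<pi> by unfold_locales auto
  define u where "u = (\<pi> 2 - a2) * x 2"
  \<comment> \<open>The three terms in turn let generator 1 fill the line, make the bid differ from
    the current one, and bring the payoff on \<open>D - C\<close> to at least
    \<open>u + 1\<close>.\<close>
  define P where "P = max (max (bid_q (b 1)) (bid_q (b 2) + 1)) (a2 + (u + 1) / (D - C))"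
  have s: "0 \<le> left_slope (b i) y" "left_slope (b i) y \<le> bid_q (b i)" if "i \<in> {1, 2}" for i y
    using left_slope_bounds valid that by auto
  have P: "bid_q (b 1) \<le> P" "bid_q (b 2) < P" "a2 + (u + 1) / (D - C) \<le> P"
    by (auto simp: P_def)
  have "Bid P 0 P \<in> valid_bids" using P(1) s[of 1 0] by (auto simp: valid_bids_def)
  then have "(P - a2) * (D - C) \<le> u"
    using C P s[of 1 C] s[of 2 1]
    unfolding u_def by (intro linear_deviation2[where z = 1]) auto
  moreover have "u + 1 \<le> (P - a2) * (D - C)"
    using P(3) D by (simp add: field_simps)
  ultimately show False by simp
qed

lemma no_equilibrium_capped:
  assumes a: "a2 < a"
  shows "\<not> nash_equilibrium N (capped_bids a) b x \<pi>"
proof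
  assume n: "nash_equilibrium N (capped_bids a) b x \<pi>"
  then interpret equilibrium Y C D a1 a2 "capped_bids a" b x \<pi>
    by unfold_locales (auto simp: capped_bids_def)
  define p1 s1 q1 where "p1 = bid_p (b 1)" and "s1 = bid_s (b 1)" and "q1 = bid_q (b 1)"
  define p2 s2 q2 where "p2 = bid_p (b 2)" and "s2 = bid_s (b 2)" and "q2 = bid_q (b 2)"
  have v: "0 \<le> p1" "p1 \<le> q1" "0 \<le> s1" "q1 \<le> a" "0 \<le> p2" "p2 \<le> q2" "0 \<le> s2" "q2 \<le> a"
    using n by (auto simp: nash_equilibrium_def gens_N capped_bids_def valid_bids_def
      p1_def s1_def q1_def p2_def s2_def q2_def)
  define l1 r1 l2 r2 where "l1 = left_slope (b 1)" and "r1 = right_slope (b 1)"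
    and "l2 = left_slope (b 2)" and "r2 = right_slope (b 2)"
  have l1: "l1 y = (if y \<le> s1 then p1 else q1)" and r1: "r1 y = (if y < s1 then p1 else q1)"
    and l2: "l2 y = (if y \<le> s2 then p2 else q2)" and r2: "r2 y = (if y < s2 then p2 else q2)" for y
    by (auto simp: l1_def r1_def l2_def r2_def left_slope_def right_slope_def
      p1_def s1_def q1_def p2_def s2_def q2_def)
  have \<pi>2: "\<pi> 2 = (if x 1 = 0 then l2 D else max (l1 (x 1)) (l2 (x 2)))"
    and \<pi>1: "\<pi> 1 = (if x 1 = C then l1 C else \<pi> 2)"
    using outcome by (auto simp: lmp1_def lmp2_def l1_def l2_def)
  have linear: "Bid P 0 P \<in> capped_bids a" if "0 \<le> P" "P \<le> a" for P
    using that by (auto simp: capped_bids_def valid_bids_def)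
  note dev1 = linear_deviation1[folded l1_def l2_def r2_def, OF linear]
  note dev2 = linear_deviation2[folded l1_def l2_def r1_def, OF linear]
  have \<pi>2_le: "\<pi> 2 \<le> a" using v by (auto simp: \<pi>2 l1 l2)
  have x2: "D - C \<le> x 2" using outcome by simp

  have guarantee: "(a - a2) * (D - C) \<le> (\<pi> 2 - a2) * x 2"
  \<comment> \<open>If the left slope is already \<open>a\<close>, the flat bid \<open>a\<close> may
    be the current bid and so no deviation; the price is then \<open>a\<close> anyway.\<close>
  proof (cases "l2 (x 2) = a")
    case True
    then have "\<pi> 2 = a" using \<pi>2_le outcome(3) by (auto simp: \<pi>2 split: if_splits)
    then show ?thesis using x2 a by simp
  next
    case False
    then show ?thesis
      using v C D a a1 a12 x2 by (intro dev2[where z = "x 2"]) (auto simp: l1)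
  qed
  have "0 < (a - a2) * (D - C)" using a D by simp
  with guarantee have "0 < (\<pi> 2 - a2) * x 2" by simp
  then have \<pi>2_gt: "a2 < \<pi> 2" using x2 D by (simp add: zero_less_mult_iff)

  consider (first) "0 < x 1" "\<pi> 2 = l1 (x 1)"
    | (second) "x 1 < C" "\<pi> 2 = l2 (x 2)"
    | (congested) "x 1 = C" "l1 C < \<pi> 2" "\<pi> 2 = l2 (D - C)"
    using outcome(1-3) C by (cases "x 1 = 0"; cases "x 1 = C"; cases "l1 (x 1) < l2 (x 2)") (auto simp: \<pi>2 max_def)
  then show False
  proof cases
    case first
    \<comment> \<open>\<open>y\<close> is what generator 1 still sells when undercut: only what it bid strictly below \<open>\<pi> 2\<close>.\<close>
    define y where "y = (if p1 < \<pi> 2 then s1 else 0)"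
    \<comment> \<open>Staying above \<open>K\<close> keeps generator 1 willing to sell
      \<open>s1\<close> when \<open>p1 < \<pi> 2\<close>, and keeps the new bid nonnegative
      otherwise.\<close>
    define K where "K = (if p1 < \<pi> 2 then p1 else 0)"
    have y: "0 \<le> y" "y < x 1"
      using first v by (auto simp: y_def l1 split: if_splits)
    have K: "0 \<le> K" "K < \<pi> 2"
      using v \<pi>2_gt a1 a12 by (auto simp: K_def)
    have "(\<pi> 2 - a2) * x 2 < (\<pi> 2 - a2) * (D - y)" and "0 < D - y"
      using y \<pi>2_gt outcome D by auto
    with K obtain P where P: "K < P" "P < \<pi> 2" "(\<pi> 2 - a2) * x 2 < (P - a2) * (D - y)" "P \<noteq> l2 1"
      using slightly_lower_price by metis
    have lo: "0 < y \<Longrightarrow> l1 y \<le> P"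
      using P(1) by (auto simp: y_def K_def l1 split: if_splits)
    have hi: "P \<le> r1 y"
      using P(2) first v by (auto simp: y_def l1 r1 split: if_splits)
    have "(P - a2) * (D - y) \<le> (\<pi> 2 - a2) * x 2"
      using P K y \<pi>2_le outcome(2) lo hi by (intro dev2[where z = 1]) auto
    with P(3) show False by simp
  next
    case second
    \<comment> \<open>Undercut, generator 2 keeps only the \<open>s2\<close> units it bid strictly
      below \<open>\<pi> 2\<close>, or \<open>D - C\<close> if the line fills first; generator 1
      serves the rest.\<close>
    define y where "y = (if p2 < \<pi> 2 then min C (D - s2) else C)"
    define K where "K = (if p2 < \<pi> 2 then p2 else 0)"
    have y: "x 1 < y" "y \<le> C"
      using second v outcome(3) by (auto simp: y_def l2 split: if_splits)
    have K: "0 \<le> K" "K < \<pi> 2"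
      using v \<pi>2_gt a1 a12 by (auto simp: K_def)
    have "(\<pi> 2 - a1) * x 1 < (\<pi> 2 - a1) * y" and "0 < y"
      using y \<pi>2_gt outcome(1) a12 by auto
    with K obtain P where P: "K < P" "P < \<pi> 2" "(\<pi> 2 - a1) * x 1 < (P - a1) * y" "P \<noteq> l1 1"
      using slightly_lower_price by metis
    have hi: "P \<le> r2 (D - y)"
      using P(2) second v by (auto simp: y_def l2 r2 min_def split: if_splits)
    have lo: "y < C \<Longrightarrow> l2 (D - y) \<le> P"
      using P(1) by (auto simp: y_def K_def l2 min_def split: if_splits)
    have "(P - a1) * y \<le> (\<pi> 1 - a1) * x 1"
      using P K y \<pi>2_le outcome(1) lo hi by (intro dev1[where z = 1]) auto
    moreover have "\<pi> 1 = \<pi> 2" using \<pi>1 second(1) by simp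
    ultimately show False using P(3) by simp
  next
    case congested
    \<comment> \<open>Since \<open>P\<close> stays below node 2's price, generator 1 still fills the
      line, and it was paid only \<open>l1 C\<close> before.\<close>
    obtain P where P: "l1 C < P" "P < \<pi> 2" using congested dense by blast
    have "0 \<le> l1 C" "\<pi> 2 \<le> r2 (D - C)"
      using v congested(3) by (auto simp: l1 l2 r2)
    then have "(P - a1) * C \<le> (\<pi> 1 - a1) * x 1"
      using P C \<pi>2_le by (intro dev1[where z = C]) auto
    moreover have "\<pi> 1 = l1 C" using \<pi>1 congested(1) by simp
    ultimately show False using congested(1) P(1) C by simp
  qed
qed

end

theorem mainTheorem1:
  fixes Y C D a1 a2 :: real
  assumes "Y > 0" and "C > 0" and "D > C" and "0 \<le> a1" and "a1 < a2"
  shows "\<not> (\<exists>b x \<pi>. nash_equilibrium (two_node_network Y C D a1 a2) valid_bids b x \<pi>) \<and>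
         (\<exists>a0. \<forall>a\<ge>a0. \<not> (\<exists>b x \<pi>.
            nash_equilibrium (two_node_network Y C D a1 a2) (capped_bids a) b x \<pi>))"
proof -
  interpret two_nodes Y C D a1 a2 using assms by unfold_locales
  \<comment> \<open>The threshold \<open>a2 + 1\<close> supplies the strict inequality
    \<open>a2 < a\<close>.\<close>
  have "\<forall>a\<ge>a2 + 1. \<not> (\<exists>b x \<pi>. nash_equilibrium N (capped_bids a) b x \<pi>)"
    using no_equilibrium_capped by force
  then show ?thesis using no_equilibrium_uncapped by blast
qed

end
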